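(* Let $p(z)=a_dz^d+\dots+a_1z+a_0\in\mathbb{Z}[z]$ with $d\ge 1$ and $a_d>0$, and let $\phi:\mathbb{N}\to\{-1,1\}$ be a 2-colouring of $\mathbb{N}$. Then either there is no monochromatic solution to $x+y=p(z)$, or there are infinitely many monochromatic solutions.
   Context: $\mathbb{N}=\{1,2,3,\dots\}$. A monochromatic solution of $x+y=p(z)$ is a triple $(x,y,z)\in\mathbb{N}^3$ (not necessarily distinct entries, so trivial solutions such as $x=y=z$ are included) with $x+y=p(z)$ and $\phi(x)=\phi(y)=\phi(z)$. *)

theory Defs
  imports "HOL-Computational_Algebra.Polynomial"
begin

(* The natural numbers of the paper start at 1, hence the positivity conditions below;
   the value of a colouring at 0 is irrelevant. *)

definition two_colouring :: "(nat \<Rightarrow> int) \<Rightarrow> bool" where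
  "two_colouring \<phi> \<longleftrightarrow> (\<forall>n\<ge>1. \<phi> n \<in> {-1, 1})"

definition mono_solutions :: "int poly \<Rightarrow> (nat \<Rightarrow> int) \<Rightarrow> (nat \<times> nat \<times> nat) set" where
  "mono_solutions p \<phi> =
    {(x, y, z). x \<ge> 1 \<and> y \<ge> 1 \<and> z \<ge> 1 \<and>
       int x + int y = poly p (int z) \<and> \<phi> x = \<phi> y \<and> \<phi> y = \<phi> z}"

end

theory Submission
  imports Defs
begin

text \<open>
  Suppose there are only finitely many monochromatic solutions. If \<open>z\<close> and \<open>w\<close> are large and
  differently coloured, then reflecting in \<open>p(z)\<close> and then in \<open>p(w)\<close> shows that the colour class
  of \<open>z\<close> is closed under translation by \<open>p(w) - p(z)\<close>, as long as one stays below \<open>p(z)\<close>.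
  A set closed under a step \<open>g\<close> up and a step \<open>h\<close> down is invariant under both on every
  interval of length \<open>g + h\<close>, where the two steps act as a rotation. For a colour change \<open>z\<close>, the
  step \<open>D = p(z + 1) - p(z)\<close> makes both colours occur in every interval of length \<open>D\<close> around
  \<open>W = p(z)/2\<close>, and \<open>p\<close> varies little on an interval of length \<open>O(D)\<close> at \<open>W\<close>; hence all
  differences of values of \<open>p\<close> there are periods of the colouring on \<open>[1, p(W) - 1]\<close>.
  By Euclid's algorithm so is their greatest common divisor, which divides the \<open>d\<close>-th difference
  \<open>A = d! a\<^sub>d\<close>. So the colouring is \<open>A\<close>-periodic everywhere, and a single solution
  \<open>(x, y, z)\<close> gives rise to the solutions \<open>(x, p(z + kA) - x, z + kA)\<close>.
\<close>

section \<open>Forward differences of polynomials\<close>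

definition diff_poly :: "int poly \<Rightarrow> int poly" where
  "diff_poly p = pcompose p [:1, 1:] - p"

lemma poly_diff_poly: "poly (diff_poly p) x = poly p (x + 1) - poly p x"
  by (simp add: diff_poly_def poly_pcompose add.commute)

lemma diff_poly_pCons: "diff_poly (pCons a p) = pCons 0 (diff_poly p) + pcompose p [:1, 1:]"
  by (simp add: diff_poly_def pcompose_pCons algebra_simps)

text \<open>The difference of \<open>a + x * p(x)\<close> is \<open>x\<close> times the difference
  of \<open>p\<close> plus \<open>p(x + 1)\<close>; both contribute to the leading
  coefficient.\<close>

lemma lead_coeff_diff_poly_aux:
  assumes "p \<noteq> 0"
  shows "degree (diff_poly p) \<le> degree p - 1 \<and>
    (degree p \<ge> 1 \<longrightarrow> coeff (diff_poly p) (degree p - 1) = int (degree p) * lead_coeff p)"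
  using assms
proof (induction p rule: pCons_induct)
  case 0
  then show ?case by simp
next
  case (pCons a p)
  show ?case
  proof (cases "p = 0")
    case True
    then show ?thesis by (simp add: diff_poly_def)
  next
    case False
    note IH = pCons.IH[OF False]
    have deg: "degree (pcompose p [:1, 1:]) = degree p"
      by (simp add: degree_pcompose)
    have lc: "coeff (pcompose p [:1, 1:]) (degree p) = lead_coeff p"
      using lead_coeff_comp[of "[:1, 1:]" p] deg by simp
    show ?thesis
    proof (cases "degree p = 0")
      case True
      then obtain b where "p = [:b:]" by (rule degree_eq_zeroE)
      then show ?thesis using False by (simp add: diff_poly_def pcompose_pCons)
    next
      case nz: False
      have "degree (pCons 0 (diff_poly p)) \<le> degree p"
        using degree_pCons_le[of 0 "diff_poly p"] IH nz by linarith
      then have "degree (diff_poly (pCons a p)) \<le> degree p"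
        unfolding diff_poly_pCons using deg by (intro degree_add_le) auto
      moreover have "coeff (pCons 0 (diff_poly p)) (degree p) = int (degree p) * lead_coeff p"
        using IH nz coeff_pCons_Suc[of 0 "diff_poly p" "degree p - 1"] by simp
      then have "coeff (diff_poly (pCons a p)) (degree p) = int (degree p + 1) * lead_coeff p"
        using lc by (simp add: diff_poly_pCons algebra_simps)
      ultimately show ?thesis using False by simp
    qed
  qed
qed

lemma
  assumes "degree p \<ge> 1"
  shows degree_diff_poly: "degree (diff_poly p) = degree p - 1"
    and lead_coeff_diff_poly: "lead_coeff (diff_poly p) = int (degree p) * lead_coeff p"
proof -
  have nz: "p \<noteq> 0" using assms by auto
  then have "lead_coeff p \<noteq> 0" by simp
  then have c: "coeff (diff_poly p) (degree p - 1) = int (degree p) * lead_coeff p"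
    "coeff (diff_poly p) (degree p - 1) \<noteq> 0"
    using lead_coeff_diff_poly_aux[OF nz] assms by auto
  show deg: "degree (diff_poly p) = degree p - 1"
    using le_degree[OF c(2)] lead_coeff_diff_poly_aux[OF nz] by simp
  show "lead_coeff (diff_poly p) = int (degree p) * lead_coeff p"
    using c(1) deg by simp
qed

text \<open>Each differencing uses up one point and lowers the degree by one; the constant left at
  the end is \<open>d! * a_d\<close>.\<close>

lemma dvd_fact_lead_coeff:
  assumes "\<And>i. i \<le> degree p \<Longrightarrow> g dvd poly p (W + int i)"
  shows "g dvd fact (degree p) * lead_coeff p"
  using assms
proof (induction "degree p" arbitrary: p)
  case 0
  then obtain a where "p = [:a:]" by (metis degree_eq_zeroE)
  then show ?case using 0(2)[of 0] by simp
next
  case (Suc n)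
  have deg: "degree (diff_poly p) = n" using degree_diff_poly[of p] Suc(2) by simp
  have "g dvd poly (diff_poly p) (W + int i)" if "i \<le> n" for i
    using Suc.prems[of i] Suc.prems[of "Suc i"] that Suc(2)
    by (simp add: poly_diff_poly algebra_simps)
  then have "g dvd fact (degree (diff_poly p)) * lead_coeff (diff_poly p)"
    using Suc(1) deg by metis
  then show ?case
    unfolding deg using lead_coeff_diff_poly[of p] Suc(2)[symmetric] deg by (simp add: algebra_simps)
qed

section \<open>Growth of polynomials\<close>

lemma poly_int_eventually_pos:
  fixes p :: "int poly"
  assumes "lead_coeff p > 0"
  shows "\<exists>N. \<forall>x\<ge>N. poly p x > 0"
  using assms
proof (induction p rule: pCons_induct)
  case 0
  then show ?case by simp
next
  case (pCons a p)
  show ?case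
  proof (cases "p = 0")
    case True
    then show ?thesis using pCons.prems by simp
  next
    case False
    then obtain N where N: "\<forall>x\<ge>N. poly p x > 0" using pCons by auto
    have "poly (pCons a p) x > 0" if "x \<ge> max N (\<bar>a\<bar> + 1)" for x
    proof -
      have "poly p x \<ge> 1" using N that by (simp add: int_one_le_iff_zero_less)
      then have "x * 1 \<le> x * poly p x" using that by (intro mult_left_mono) auto
      then have "x \<le> x * poly p x" by simp
      then show ?thesis using that abs_ge_minus_self[of a] unfolding poly_pCons by linarith
    qed
    then show ?thesis by blast
  qed
qed

text \<open>The difference has lower degree, so the leading term of \<open>p\<close> wins. With
  \<open>A = 0\<close> this says that \<open>p\<close> passes every bound.\<close>

lemma poly_dominates_diff:
  fixes p :: "int poly"
  assumes "degree p \<ge> 1" "lead_coeff p > 0"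
  shows "\<exists>N. \<forall>x\<ge>N. poly p x > A * (poly p (x + 1) - poly p x) + B"
proof -
  let ?q = "p - (smult A (diff_poly p) + [:B:])"
  have "degree (smult A (diff_poly p) + [:B:]) < degree p"
    using assms degree_diff_poly[of p] degree_smult_le[of A "diff_poly p"]
    by (intro degree_add_less) auto
  then have less: "degree (- (smult A (diff_poly p) + [:B:])) < degree p"
    by (simp only: degree_minus)
  have deg: "degree ?q = degree p"
    using degree_add_eq_left[OF less] by (simp only: diff_conv_add_uminus)
  moreover have "lead_coeff ?q = lead_coeff p"
    using coeff_eq_0[OF less] unfolding deg coeff_diff coeff_minus by linarith
  then obtain N where "\<forall>x\<ge>N. poly ?q x > 0"
    using poly_int_eventually_pos[of ?q] assms by auto
  then show ?thesis by (auto simp: poly_diff_poly)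
qed

lemma poly_eventually_near_monom:
  fixes p :: "int poly"
  assumes "lead_coeff p > 0"
  defines "d \<equiv> degree p" and "a \<equiv> lead_coeff p"
  shows "\<exists>N. \<forall>x\<ge>N. 9 * a * x ^ d < 10 * poly p x \<and> 10 * poly p x < 11 * a * x ^ d"
proof -
  have lc: "lead_coeff q > 0" if "degree q \<le> d" "coeff q d = a" for q
  proof -
    have "degree q = d" using that assms le_degree[of q d] by force
    then show ?thesis using that assms by simp
  qed
  let ?q = "smult 10 p - monom (9 * a) d" and ?r = "monom (11 * a) d - smult 10 p"
  have "degree ?q \<le> d" "degree ?r \<le> d"
    by (auto intro!: degree_diff_le simp: d_def degree_monom_le)
  moreover have "coeff ?q d = a" "coeff ?r d = a"
    by (auto simp: a_def d_def)
  ultimately obtain M N where "\<forall>x\<ge>M. poly ?q x > 0" "\<forall>x\<ge>N. poly ?r x > 0"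
    using lc poly_int_eventually_pos by meson
  then show ?thesis
    by (intro exI[of _ "max M N"]) (auto simp: poly_monom)
qed

text \<open>Moving \<open>y\<close> by at most \<open>y / C\<close> multiplies \<open>y ^ d\<close>
  by at most 10/9; together with the errors 11/10 and 10/9 of the monomial approximation this gives
  110/81 < 3/2.\<close>

lemma poly_slowly_varying:
  fixes p :: "int poly"
  assumes "degree p \<ge> 1" "lead_coeff p > 0"
  shows "\<exists>C\<ge>1. \<exists>N. \<forall>y\<ge>N. \<forall>k\<ge>0. C * k \<le> y \<longrightarrow> 2 * poly p (y + k) < 3 * poly p y"
proof -
  define d where "d = degree p"
  define a where "a = lead_coeff p"
  define C where "C = 10 * int d - 1"
  have d: "d \<ge> 1" and a: "a > 0" and C: "C \<ge> 1" using assms by (auto simp: d_def a_def C_def)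
  obtain N where N: "\<forall>x\<ge>N. 9 * a * x ^ d < 10 * poly p x \<and> 10 * poly p x < 11 * a * x ^ d"
    using poly_eventually_near_monom[OF assms(2)] unfolding a_def d_def by blast
  \<comment> \<open>\<open>C\<close> is chosen so that Bernoulli gives \<open>(C / (C + 1)) ^ d \<ge> 1 - d / (C + 1) = 9 / 10\<close>.\<close>
  have bern: "9 * (C + 1) ^ d \<le> 10 * C ^ d"
  proof -
    have "1 + real d * (- 1 / (10 * real d)) \<le> (1 + (- 1 / (10 * real d))) ^ d"
      using d by (intro Bernoulli_inequality) (simp add: field_simps)
    then have "9 / 10 \<le> (1 + (- 1 / (10 * real d))) ^ d" using d by simp
    also have "1 + (- 1 / (10 * real d)) = of_int C / of_int (C + 1)"
      using d by (simp add: C_def field_simps)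
    finally have "9 * of_int (C + 1) ^ d \<le> 10 * (of_int C :: real) ^ d"
      using C by (simp add: power_divide field_simps)
    then have "real_of_int (9 * (C + 1) ^ d) \<le> real_of_int (10 * C ^ d)" by simp
    then show ?thesis by linarith
  qed
  have "2 * poly p (y + k) < 3 * poly p y" if y: "y \<ge> max N 1" and k: "k \<ge> 0" "C * k \<le> y" for y k
  proof -
    have "C ^ d * (9 * (y + k) ^ d) = 9 * (C * (y + k)) ^ d" by (simp add: power_mult_distrib)
    also have "\<dots> \<le> 9 * ((C + 1) * y) ^ d"
      using k y C by (intro mult_left_mono power_mono) (auto simp: algebra_simps)
    also have "\<dots> = (9 * (C + 1) ^ d) * y ^ d" by (simp add: power_mult_distrib)
    also have "\<dots> \<le> (10 * C ^ d) * y ^ d" using bern y by (intro mult_right_mono) auto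
    finally have "C ^ d * (9 * (y + k) ^ d) \<le> C ^ d * (10 * y ^ d)" by (simp add: algebra_simps)
    then have "9 * (y + k) ^ d \<le> 10 * y ^ d" using C by (simp add: mult_le_cancel_left)
    then have "a * (9 * (y + k) ^ d) \<le> a * (10 * y ^ d)" using a by (intro mult_left_mono) auto
    moreover have "10 * poly p (y + k) < 11 * (a * (y + k) ^ d)" "9 * (a * y ^ d) < 10 * poly p y"
      using N y k by (auto simp: mult.assoc)
    moreover have "a * y ^ d > 0" using a y by simp
    ultimately show ?thesis by simp
  qed
  then show ?thesis using C by blast
qed

section \<open>Periods of a colouring on an interval\<close>

text \<open>Both ends must lie in the interval, so \<open>g\<close> may have either sign, and any
  \<open>g\<close> with \<open>\<bar>g\<bar> \<ge> M\<close> qualifies vacuously.\<close>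

definition period_on :: "(int \<Rightarrow> bool) \<Rightarrow> int \<Rightarrow> int \<Rightarrow> bool" where
  "period_on c M g \<longleftrightarrow> (\<forall>x\<in>{1..M}. x + g \<in> {1..M} \<longrightarrow> c (x + g) = c x)"

lemma period_on_uminus: "period_on c M g \<Longrightarrow> period_on c M (- g)"
  unfolding period_on_def by (metis diff_add_cancel uminus_add_conv_diff add.commute)

text \<open>By the size bound, at least one order of the two steps has its intermediate point inside
  the interval.\<close>

lemma period_on_add:
  assumes "period_on c M g" "period_on c M h" "\<bar>g\<bar> + \<bar>h\<bar> \<le> M"
  shows "period_on c M (g + h)"
  unfolding period_on_def
proof (intro ballI impI)
  fix x assume x: "x \<in> {1..M}" "x + (g + h) \<in> {1..M}"
  then consider "x + g \<in> {1..M}" | "x + h \<in> {1..M}" using assms(3) by force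
  then show "c (x + (g + h)) = c x"
  proof cases
    case 1
    then show ?thesis
      using assms(1,2) x unfolding period_on_def by (metis add.assoc)
  next
    case 2
    then show ?thesis
      using assms(1,2) x unfolding period_on_def by (metis add.assoc add.commute)
  qed
qed

lemma period_on_mult:
  assumes "period_on c M g"
  shows "period_on c M (int k * g)"
proof (induction k)
  case 0
  then show ?case by (simp add: period_on_def)
next
  case (Suc k)
  show ?case
    unfolding period_on_def
  proof (intro ballI impI)
    fix x assume x: "x \<in> {1..M}" "x + int (Suc k) * g \<in> {1..M}"
    have eq: "x + int (Suc k) * g = x + int k * g + g" by (simp add: algebra_simps)
    have "x + int k * g \<in> {1..M}"
    proof (cases "g \<ge> 0")
      case True
      then have "int k * g \<ge> 0" by simp
      then show ?thesis using x True unfolding eq atLeastAtMost_iff by linarith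
    next
      case False
      then have "int k * g \<le> 0" by (simp add: mult_le_0_iff)
      then show ?thesis using x False unfolding eq atLeastAtMost_iff by linarith
    qed
    then show "c (x + int (Suc k) * g) = c x"
      using Suc assms x unfolding eq period_on_def by metis
  qed
qed

text \<open>Euclid's algorithm by subtraction: passing from \<open>(u, v)\<close> to
  \<open>(u, v - u)\<close> only shrinks the sum, so the bound for adding periods persists.\<close>

lemma period_on_gcd:
  assumes "period_on c M (int g)" "period_on c M (int h)" "int g + int h \<le> M"
  shows "period_on c M (int (gcd g h))"
  using assms
proof (induction "g + h" arbitrary: g h rule: less_induct)
  case less
  have sub: "period_on c M (int (gcd u v))"
    if "u + v = g + h" "period_on c M (int u)" "period_on c M (int v)" "u \<le> v" for u v
  proof (cases "u = 0")
    case True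
    then show ?thesis using that by simp
  next
    case False
    have sum: "int u + int v \<le> M" using that(1) less.prems(3) by linarith
    have "period_on c M (int v + - int u)"
      using period_on_add[OF that(3) period_on_uminus[OF that(2)]] sum by simp
    then have "period_on c M (int (v - u))" using that(4) by (simp add: of_nat_diff)
    then have "period_on c M (int (gcd u (v - u)))"
      using less.hyps[of u "v - u"] False that sum by simp
    then show ?thesis using that(4) by (metis gcd.commute gcd_diff1_nat)
  qed
  show ?case
    using sub[of g h] sub[of h g] less.prems by (metis add.commute gcd.commute nat_le_linear)
qed

text \<open>On \<open>g + h\<close> consecutive integers, moving the first \<open>h\<close> up by
  \<open>g\<close> and the rest down by \<open>h\<close> is injective. It maps the finite part of
  \<open>S\<close> there into itself, hence onto itself, and only \<open>x\<close> goes to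
  \<open>x + g\<close>.\<close>

lemma rotation_backward:
  fixes S :: "int set"
  assumes up: "\<And>x. x \<in> S \<Longrightarrow> 1 \<le> x \<Longrightarrow> x + g \<le> M \<Longrightarrow> x + g \<in> S"
    and down: "\<And>x. x \<in> S \<Longrightarrow> x \<le> M \<Longrightarrow> 1 \<le> x - h \<Longrightarrow> x - h \<in> S"
    and "g > 0" "h > 0" "g + h \<le> M"
    and x: "1 \<le> x" "x + g \<le> M" "x + g \<in> S"
  shows "x \<in> S"
proof -
  \<comment> \<open>This puts the window \<open>s + 1..s + g + h\<close> inside
    \<open>[1, M]\<close> with \<open>x\<close> among its first \<open>h\<close> points.\<close>
  define s where "s = min (x - 1) (M - g - h)"
  define f where "f u = (if u \<le> s + h then u + g else u - h)" for u
  define T where "T = S \<inter> {s + 1..s + g + h}"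
  have s: "s \<ge> 0" "s + g + h \<le> M" "s + 1 \<le> x" "x \<le> s + h"
    using assms by (auto simp: s_def)
  have inj: "inj_on f {s + 1..s + g + h}"
    by (auto simp: inj_on_def f_def split: if_splits)
  then have injT: "inj_on f T" by (rule inj_on_subset) (auto simp: T_def)
  have "f u \<in> T" if "u \<in> T" for u
    using that up[of u] down[of u] s \<open>g > 0\<close> \<open>h > 0\<close> by (auto simp: T_def f_def)
  then have "f ` T = T"
    by (intro endo_inj_surj injT) (auto simp: T_def)
  moreover have "x + g \<in> T" using s x \<open>g > 0\<close> by (auto simp: T_def)
  ultimately obtain u where u: "u \<in> T" "f u = x + g" by (metis imageE)
  have "f x = x + g" using s by (simp add: f_def)
  then have "u = x"
    using u inj s \<open>g > 0\<close> \<open>h > 0\<close> by (auto simp: inj_on_def T_def)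
  then show ?thesis using u by (simp add: T_def)
qed

text \<open>\<open>rotation_backward\<close> turns closure of the class of colour \<open>k\<close>
  into invariance; as colours are Boolean, the other class is then invariant too.\<close>

lemma period_on_of_steps:
  assumes up: "\<And>x. c x = k \<Longrightarrow> 1 \<le> x \<Longrightarrow> x + g \<le> M \<Longrightarrow> c (x + g) = k"
    and down: "\<And>x. c x = k \<Longrightarrow> x \<le> M \<Longrightarrow> 1 \<le> x - h \<Longrightarrow> c (x - h) = k"
    and gh: "g > 0" "h > 0" "g + h \<le> M"
  shows "period_on c M g" "period_on c M h"
proof -
  have bwd: "c x = k" if "1 \<le> x" "x + g \<le> M" "c (x + g) = k" for x
    using rotation_backward[of "{x. c x = k}" g M h x] assms that by auto
  have "c (x + g) = c x" if "1 \<le> x" "x + g \<le> M" for x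
    using up[of x] bwd[of x] that by blast
  then show "period_on c M g" by (auto simp: period_on_def)
  \<comment> \<open>The reflection \<open>y \<mapsto> M + 1 - y\<close> exchanges the roles of \<open>g\<close> and \<open>h\<close>.\<close>
  have bwd': "c x = k" if "x \<le> M" "1 \<le> x - h" "c (x - h) = k" for x
  proof -
    have up': "c (M + 1 - (y + h)) = k" if "c (M + 1 - y) = k" "1 \<le> y" "y + h \<le> M" for y
      using down[of "M + 1 - y"] that by (simp add: algebra_simps)
    have down': "c (M + 1 - (y - g)) = k" if "c (M + 1 - y) = k" "y \<le> M" "1 \<le> y - g" for y
      using up[of "M + 1 - y"] that by (simp add: algebra_simps)
    have "M + 1 - x \<in> {y. c (M + 1 - y) = k}"
      using rotation_backward[of "{y. c (M + 1 - y) = k}" h M g "M + 1 - x"] up' down' gh that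
      by (auto simp: algebra_simps)
    then show ?thesis by simp
  qed
  have "c (x + h) = c x" if "1 \<le> x" "x + h \<le> M" for x
    using bwd'[of "x + h"] down[of "x + h"] that by auto
  then show "period_on c M h" by (auto simp: period_on_def)
qed

section \<open>Colourings without large monochromatic solutions\<close>

text \<open>What finitely many solutions leave: \<open>N\<close> lies beyond all their third entries
  and where \<open>p\<close> has become increasing.\<close>

locale eventually_solution_free =
  fixes p :: "int poly" and c :: "int \<Rightarrow> bool" and N :: int
  assumes N_pos: "N \<ge> 1"
    and poly_less: "N \<le> z \<Longrightarrow> z < w \<Longrightarrow> poly p z < poly p w"
    and no_solution: "\<lbrakk>N \<le> z; 1 \<le> x; 1 \<le> y; x + y = poly p z; c x = c y; c y = c z\<rbrakk> \<Longrightarrow> False"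
begin

lemma poly_le: "N \<le> z \<Longrightarrow> z \<le> w \<Longrightarrow> poly p z \<le> poly p w"
  using poly_less[of z w] by (cases "z = w") auto

text \<open>\<open>poly p z - x\<close> must have the colour of \<open>w\<close>, so its reflection
  in \<open>poly p w\<close>, the translate of \<open>x\<close>, must not.\<close>

lemma colour_step:
  assumes "N \<le> z" "N \<le> w" "c z \<noteq> c w" "c x = c z" "1 \<le> x" "x < poly p z"
    "1 \<le> x + (poly p w - poly p z)"
  shows "c (x + (poly p w - poly p z)) = c z"
proof -
  have "c (poly p z - x) \<noteq> c z"
    using no_solution[of z x "poly p z - x"] assms by auto
  moreover have "c (x + (poly p w - poly p z)) \<noteq> c w \<or> c (poly p z - x) \<noteq> c w"
    using no_solution[of w "x + (poly p w - poly p z)" "poly p z - x"] assms by auto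
  ultimately show ?thesis using assms by auto
qed

text \<open>The alternating colours of \<open>a\<close>, \<open>b\<close>, \<open>e\<close> give the
  class of \<open>a\<close> a step up and a step down, so that every step between opposite colours
  has a partner in the other direction. \<open>small\<close> makes two steps fit into the
  interval.\<close>

lemma period_on_diff_if_window:
  assumes W: "N \<le> W" "W \<le> a" "a < b" "b < e" "e \<le> V"
    and col: "c a \<noteq> c b" "c b \<noteq> c e"
    and small: "2 * (poly p V - poly p W) < poly p W"
    and zw: "z \<in> {W..V}" "w \<in> {W..V}"
  shows "period_on c (poly p W - 1) (poly p w - poly p z)"
proof -
  let ?M = "poly p W - 1" and ?P = "poly p"
  have bound: "?P W \<le> ?P u" "?P u \<le> ?P V" "N \<le> u" if "u \<in> {W..V}" for u
    using that poly_le[of W u] poly_le[of u V] W(1) by auto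
  have in_W: "a \<in> {W..V}" "b \<in> {W..V}" "e \<in> {W..V}" using W by auto
  have step: "c (x + (?P v - ?P u)) = k"
    if "u \<in> {W..V}" "v \<in> {W..V}" "c u = k" "c v \<noteq> k" "c x = k" "1 \<le> x" "x \<le> ?M"
      "1 \<le> x + (?P v - ?P u)" for u v x k
    using colour_step[of u v x] bound[of u] bound[of v] that by auto
  have g: "?P b > ?P a" "?P e > ?P b"
    using poly_less[of a b] poly_less[of b e] W by auto
  have sum_le: "(?P v - ?P u) + (?P v' - ?P u') \<le> ?M"
    if "u \<in> {W..V}" "v \<in> {W..V}" "u' \<in> {W..V}" "v' \<in> {W..V}" for u v u' v'
  proof -
    have "?P v - ?P u \<le> ?P V - ?P W" "?P v' - ?P u' \<le> ?P V - ?P W"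
      using that by (auto intro!: diff_mono bound)
    then show ?thesis using small by simp
  qed
  have opposite: "period_on c ?M (?P v - ?P u)"
    if "u \<in> {W..V}" "v \<in> {W..V}" "c u = c a" "c v \<noteq> c a" for u v
  proof -
    consider "?P v = ?P u" | "?P v > ?P u" | "?P v < ?P u" by linarith
    then show ?thesis
    proof cases
      case 1
      then show ?thesis by (simp add: period_on_def)
    next
      case 2
      show ?thesis
      proof (rule period_on_of_steps(1)[where k = "c a" and h = "?P e - ?P b"])
        show "c (x + (?P v - ?P u)) = c a" if "c x = c a" "1 \<le> x" "x + (?P v - ?P u) \<le> ?M" for x
          using step[of u v "c a" x] that \<open>u \<in> _\<close> \<open>v \<in> _\<close> \<open>c u = _\<close> \<open>c v \<noteq> _\<close> 2 by auto
        show "c (x - (?P e - ?P b)) = c a" if "c x = c a" "x \<le> ?M" "1 \<le> x - (?P e - ?P b)" for x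
          using step[of e b "c a" x] that in_W col g by (auto simp: algebra_simps)
      qed (use 2 g sum_le[OF that(1,2) in_W(2,3)] in simp_all)
    next
      case 3
      have "period_on c ?M (?P u - ?P v)"
      proof (rule period_on_of_steps(2)[where k = "c a" and g = "?P b - ?P a"])
        show "c (x - (?P u - ?P v)) = c a" if "c x = c a" "x \<le> ?M" "1 \<le> x - (?P u - ?P v)" for x
          using step[of u v "c a" x] that \<open>u \<in> _\<close> \<open>v \<in> _\<close> \<open>c u = _\<close> \<open>c v \<noteq> _\<close> 3
          by (auto simp: algebra_simps)
        show "c (x + (?P b - ?P a)) = c a" if "c x = c a" "1 \<le> x" "x + (?P b - ?P a) \<le> ?M" for x
          using step[of a b "c a" x] that in_W col g by auto
      qed (use 3 g sum_le[OF in_W(1,2) that(2,1)] in simp_all)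
      then show ?thesis using period_on_uminus by fastforce
    qed
  qed
  have opposite': "period_on c ?M (?P v - ?P u)"
    if "u \<in> {W..V}" "v \<in> {W..V}" "c u \<noteq> c v" for u v
    using opposite[of u v] period_on_uminus[OF opposite[of v u]] that by (cases "c u = c a") auto
  show ?thesis
  proof (cases "c z = c w")
    case False
    then show ?thesis using opposite' zw by blast
  next
    case True
    \<comment> \<open>Equal colours: the difference is split at a point \<open>t\<close> of the
      other colour.\<close>
    obtain t where t: "t \<in> {W..V}" "c t \<noteq> c z" using in_W col by metis
    have "period_on c ?M ((?P t - ?P z) + (?P w - ?P t))"
      using bound[OF t(1)] bound[OF zw(1)] bound[OF zw(2)] small
      by (intro period_on_add opposite') (use t zw True in auto)
    then show ?thesis by simp
  qed
qed

text \<open>By Euclid the least short period divides every difference of consecutive values of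
  \<open>p\<close> on the window, and there are at least \<open>degree p\<close> of them, enough to
  reach the constant difference.\<close>

lemma period_on_fact_lead_coeff_if_window:
  assumes deg: "degree p \<ge> 1"
    and W: "N \<le> W" "W \<le> a" "a < b" "b < e" "e \<le> V" "W + int (degree p) \<le> V"
    and col: "c a \<noteq> c b" "c b \<noteq> c e"
    and small: "2 * (poly p V - poly p W) < poly p W"
  shows "period_on c (poly p W - 1) (fact (degree p) * lead_coeff p)"
proof -
  let ?M = "poly p W - 1"
  have per: "period_on c ?M (poly p w - poly p z)" if "z \<in> {W..V}" "w \<in> {W..V}" for z w
    using period_on_diff_if_window[OF W(1-5) col small that] .
  \<comment> \<open>\<open>2 * int g \<le> ?M\<close> ensures that two such periods have sum at most
    \<open>?M\<close>, as \<open>period_on_gcd\<close> asks.\<close>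
  define Q where "Q g \<longleftrightarrow> g > 0 \<and> 2 * int g \<le> ?M \<and> period_on c ?M (int g)" for g :: nat
  have diff: "Q (nat (poly p (z + 1) - poly p z))" if "W \<le> z" "z + 1 \<le> V" for z
    using per[of z "z + 1"] that poly_less[of z "z + 1"] poly_le[of W z] poly_le[of "z + 1" V] W(1) small
    by (auto simp: Q_def)
  define g where "g = (LEAST g. Q g)"
  have "Q g" unfolding g_def using diff[of W] W(6) deg by (intro LeastI) auto
  have g_dvd: "g dvd h" if "Q h" for h
  proof -
    have "gcd g h \<le> g" using \<open>Q g\<close> by (simp add: Q_def gcd_le1_nat)
    moreover have "Q (gcd g h)"
    proof -
      have "2 * int (gcd g h) \<le> 2 * int g" using calculation by simp
      then have "2 * int (gcd g h) \<le> ?M" using \<open>Q g\<close> unfolding Q_def by (meson order_trans)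
      then show ?thesis using \<open>Q g\<close> that period_on_gcd[of c ?M g h] by (auto simp: Q_def)
    qed
    ultimately have "gcd g h = g" using Least_le[of Q "gcd g h"] g_def by linarith
    then show ?thesis by (metis gcd_dvd2)
  qed
  have "int g dvd poly (diff_poly p) (W + int i)" if "i \<le> degree (diff_poly p)" for i
  proof -
    have i: "W \<le> W + int i" "W + int i + 1 \<le> V"
      using that W(6) deg degree_diff_poly[OF deg] by auto
    then have "int g dvd int (nat (poly p (W + int i + 1) - poly p (W + int i)))"
      using g_dvd diff by (simp only: of_nat_dvd_iff)
    moreover have "int (nat (poly p (W + int i + 1) - poly p (W + int i))) = poly (diff_poly p) (W + int i)"
      using poly_less[of "W + int i" "W + int i + 1"] W(1) by (simp add: poly_diff_poly)
    ultimately show ?thesis by simp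
  qed
  then have "int g dvd fact (degree p - 1) * (int (degree p) * lead_coeff p)"
    using dvd_fact_lead_coeff[of "diff_poly p" "int g" W] degree_diff_poly[OF deg]
      lead_coeff_diff_poly[OF deg] by simp
  also have "\<dots> = fact (degree p) * lead_coeff p"
    using deg by (simp add: fact_reduce[of "degree p"])
  finally obtain k where k: "fact (degree p) * lead_coeff p = int g * k" by (auto simp: dvd_def)
  have "period_on c ?M (int (nat \<bar>k\<bar>) * int g)"
    using \<open>Q g\<close> by (intro period_on_mult) (simp add: Q_def)
  then show ?thesis
    using period_on_uminus[of c ?M "\<bar>k\<bar> * int g"] k by (cases "k \<ge> 0") (auto simp: mult.commute)
qed

section \<open>Both colours in short intervals\<close>

lemma progression_same_colour:
  assumes "N \<le> z" "c z \<noteq> c (z + 1)" "1 \<le> r" "c r = c z"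
  defines "D \<equiv> poly p (z + 1) - poly p z"
  shows "r + int k * D < poly p z + D \<Longrightarrow> c (r + int k * D) = c z"
proof (induction k)
  case 0
  then show ?case using assms by simp
next
  case (Suc k)
  have D: "D > 0" using poly_less[of z "z + 1"] assms by simp
  then have "int k * D \<ge> 0" by simp
  have eq: "r + int (Suc k) * D = r + int k * D + D" by (simp add: algebra_simps)
  show ?case
    using Suc colour_step[of z "z + 1" "r + int k * D"] assms(1-3) D \<open>int k * D \<ge> 0\<close>
    unfolding eq D_def[symmetric] by auto
qed

lemma same_colour_in_interval:
  assumes "N \<le> z" "c z \<noteq> c (z + 1)" "1 \<le> r" "c r = c z"
  defines "D \<equiv> poly p (z + 1) - poly p z"
  assumes "r \<le> t" "t \<le> poly p z"
  shows "\<exists>x\<in>{t..<t + D}. c x = c z"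
proof -
  have D: "D > 0" using poly_less[of z "z + 1"] assms by simp
  \<comment> \<open>\<open>r + int k * D\<close> is to be the last term of the progression not
    beyond \<open>u\<close>, the end of the interval.\<close>
  define u where "u = t + D - 1"
  define k where "k = nat ((u - r) div D)"
  have k: "int k * D = (u - r) - (u - r) mod D"
    using assms D by (simp add: k_def u_def pos_imp_zdiv_nonneg_iff minus_mod_eq_div_mult)
  moreover have "0 \<le> (u - r) mod D" "(u - r) mod D < D" using D by simp_all
  ultimately have "r + int k * D \<in> {t..<t + D}" by (auto simp: u_def)
  moreover from this have "c (r + int k * D) = c z"
    using progression_same_colour[of z r k] assms by auto
  ultimately show ?thesis by blast
qed

text \<open>Reflection in \<open>poly p z\<close> sends the class of \<open>z\<close> into the other
  one, so it suffices to find the colour of \<open>z\<close> in the mirrored interval, which starts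
  at \<open>s\<close>.\<close>

lemma other_colour_in_interval:
  assumes z: "N \<le> z" "c z \<noteq> c (z + 1)" "1 \<le> r" "c r = c z"
  defines "D \<equiv> poly p (z + 1) - poly p z"
  assumes t: "1 \<le> t" "t + D + r \<le> poly p z"
  shows "\<exists>x\<in>{t..<t + D}. c x \<noteq> c z"
proof -
  have D: "D > 0" using poly_less[of z "z + 1"] assms by simp
  define s where "s = poly p z - t - D + 1"
  have "r \<le> s" "s \<le> poly p z" using t D by (auto simp: s_def)
  then obtain x where x: "x \<in> {s..<s + D}" "c x = c z"
    using same_colour_in_interval[OF z] unfolding D_def by blast
  then have "c (poly p z - x) \<noteq> c z"
    using no_solution[of z x "poly p z - x"] z t \<open>r \<le> s\<close> by (auto simp: s_def)
  then show ?thesis using x by (intro bexI[of _ "poly p z - x"]) (auto simp: s_def)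
qed

text \<open>If the colour were constant from \<open>m\<close> on, \<open>m + (poly p z - m)\<close>
  would be a monochromatic solution for large \<open>z\<close>.\<close>

lemma exists_colour_change:
  assumes "degree p \<ge> 1" "lead_coeff p > 0"
  shows "\<exists>z\<ge>K. c z \<noteq> c (z + 1)"
proof (rule ccontr)
  define m where "m = max K N"
  assume no_change: "\<not> ?thesis"
  have step: "c (z + 1) = c z" if "z \<ge> m" for z
  proof -
    have "z \<ge> K" using that by (simp add: m_def)
    then show ?thesis using no_change by blast
  qed
  have const: "c z = c m" if "z \<ge> m" for z
    using that by (induction z rule: int_ge_induct) (simp_all only: step)
  obtain M where M: "\<forall>z\<ge>M. poly p z > 2 * m"
    using poly_dominates_diff[OF assms, of 0 "2 * m"] by auto
  define z where "z = max M m"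
  have z: "poly p z > 2 * m" "z \<ge> m" using M by (simp_all add: z_def)
  then have "poly p z - m \<ge> m" by simp
  then have col: "c (poly p z - m) = c m" "c z = c m" using const z(2) by blast+
  have m: "m \<ge> N" "m \<ge> 1" using N_pos by (simp_all add: m_def)
  show False
  proof (rule no_solution[of z m "poly p z - m"])
    show "1 \<le> poly p z - m" using m(2) \<open>poly p z - m \<ge> m\<close> by linarith
  qed (use m z col in simp_all)
qed

text \<open>A fixed colour change \<open>z0\<close> bounds the start \<open>r\<close> of the
  progressions independently of \<open>z\<close>; a far one \<open>z\<close> has a step
  \<open>D\<close> tiny against \<open>W\<close>. Three successive intervals of length
  \<open>D\<close> from \<open>W\<close> on then contain \<open>a\<close>, \<open>b\<close>,
  \<open>e\<close>.\<close>

lemma exists_window: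
  assumes deg: "degree p \<ge> 1" and lc: "lead_coeff p > 0"
  shows "\<exists>W a b e V. K \<le> W \<and> N \<le> W \<and> W \<le> a \<and> a < b \<and> b < e \<and> e \<le> V \<and> W + int (degree p) \<le> V \<and>
    c a \<noteq> c b \<and> c b \<noteq> c e \<and> 2 * (poly p V - poly p W) < poly p W"
proof -
  obtain C Y where C: "C \<ge> 1"
    and slow: "\<And>y k. y \<ge> Y \<Longrightarrow> k \<ge> 0 \<Longrightarrow> C * k \<le> y \<Longrightarrow> 2 * poly p (y + k) < 3 * poly p y"
    using poly_slowly_varying[OF deg lc] by blast
  obtain z0 where z0: "z0 \<ge> N" "c z0 \<noteq> c (z0 + 1)" using exists_colour_change[OF deg lc] by blast
  define d where "d = int (degree p)"
  define B where "B = z0 + 1 + \<bar>K\<bar> + \<bar>Y\<bar> + N + C * d"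
  \<comment> \<open>Halving gives \<open>W \<ge> 3 * (C * D) + 3 * D + B\<close>: slow variation up
    to \<open>V\<close> needs the first term, room for three intervals below \<open>poly p z\<close>
    the second; \<open>B\<close> holds the bounds independent of \<open>z\<close>, and the 1 absorbs
    rounding.\<close>
  obtain Z where Z: "\<forall>z\<ge>Z. poly p z > (6 * C + 6) * (poly p (z + 1) - poly p z) + 2 * B + 1"
    using poly_dominates_diff[OF deg lc] by (metis add.assoc)
  obtain z where z: "z \<ge> max N Z" "c z \<noteq> c (z + 1)" using exists_colour_change[OF deg lc] by blast
  define D where "D = poly p (z + 1) - poly p z"
  define W where "W = poly p z div 2"
  define V where "V = W + (3 * D + d)"
  have D: "D > 0" using poly_less[of z "z + 1"] z by (simp add: D_def)
  have zN: "N \<le> z" using z by simp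
  have d: "d \<ge> 1" "C * d \<ge> 0" using deg C by (auto simp: d_def)
  have CD: "C * D > 0" using C D by simp
  have big: "poly p z > 6 * (C * D) + 6 * D + 2 * B + 1"
  proof -
    have "poly p z > (6 * C + 6) * D + 2 * B + 1" using Z z unfolding D_def by simp
    then show ?thesis by (simp add: distrib_right)
  qed
  have W: "2 * W \<le> poly p z" "poly p z \<le> 2 * W + 1" by (simp_all add: W_def)
  have W_ge: "W \<ge> 3 * (C * D) + 3 * D + B" using W big by linarith
  define r where "r = (if c z0 = c z then z0 else z0 + 1)"
  have r: "c r = c z" "1 \<le> r" "r \<le> z0 + 1" using z0 N_pos by (auto simp: r_def)
  have B: "B \<ge> r" "B \<ge> K" "B \<ge> Y" "B \<ge> N" "B \<ge> C * d"
    using r d z0 N_pos by (auto simp: B_def)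
  have Wlow: "r \<le> W" "1 \<le> W" "K \<le> W" "N \<le> W" "Y \<le> W"
    using W_ge B CD D r by linarith+
  have top: "W + 3 * D + r \<le> poly p z" using W W_ge B CD D by linarith
  obtain a where a: "a \<in> {W..<W + D}" "c a = c z"
    using same_colour_in_interval[OF zN z(2) r(2,1), of W] Wlow top D r(2) unfolding D_def by auto
  have "1 \<le> W + D" "W + D + D + r \<le> poly p z" using Wlow top D by simp_all
  then obtain b where b: "b \<in> {W + D..<W + D + D}" "c b \<noteq> c z"
    using other_colour_in_interval[OF zN z(2) r(2,1), of "W + D", folded D_def] by blast
  obtain e where e: "e \<in> {W + 2 * D..<W + 2 * D + D}" "c e = c z"
    using same_colour_in_interval[OF zN z(2) r(2,1), of "W + 2 * D"] Wlow top D r(2)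
    unfolding D_def by auto
  have "C * (3 * D + d) \<le> W"
    using W_ge B D by (simp add: distrib_left)
  then have "2 * (poly p V - poly p W) < poly p W"
    using slow[of W "3 * D + d"] Wlow D d by (simp add: V_def)
  moreover have "e \<le> V" "W + int (degree p) \<le> V" using e D d by (auto simp: V_def d_def)
  moreover have "W \<le> a" "a < b" "b < e" "c a \<noteq> c b" "c b \<noteq> c e"
    using a b e by simp_all
  ultimately show ?thesis using Wlow(3,4) by blast
qed

text \<open>Windows exist arbitrarily far out, so one has both points inside
  \<open>[1, poly p W - 1]\<close>.\<close>

lemma colour_periodic:
  assumes "degree p \<ge> 1" "lead_coeff p > 0" "1 \<le> x"
  shows "c (x + fact (degree p) * lead_coeff p) = c x"
proof -
  let ?A = "fact (degree p) * lead_coeff p"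
  have "?A > 0" using assms by simp
  obtain M where M: "\<forall>z\<ge>M. poly p z > x + ?A"
    using poly_dominates_diff[OF assms(1,2), of 0 "x + ?A"] by auto
  obtain W a b e V where W: "M \<le> W" "N \<le> W" "W \<le> a" "a < b" "b < e" "e \<le> V"
    "W + int (degree p) \<le> V" "c a \<noteq> c b" "c b \<noteq> c e" "2 * (poly p V - poly p W) < poly p W"
    using exists_window[OF assms(1,2)] by blast
  have "poly p W > x + ?A" using M W(1) by blast
  then have "x \<in> {1..poly p W - 1}" "x + ?A \<in> {1..poly p W - 1}"
    using assms(3) \<open>?A > 0\<close> unfolding atLeastAtMost_iff by linarith+
  then show ?thesis
    using period_on_fact_lead_coeff_if_window[OF assms(1) W(2-)] unfolding period_on_def by blast
qed

end

section \<open>A new solution from an old one\<close>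

text \<open>Used to see that \<open>p(z + k * A) - p(z)\<close> is a multiple of the period
  \<open>A\<close>.\<close>

lemma dvd_poly_add_mult_diff: "g dvd poly p (z + k * g) - poly p z" for p :: "int poly"
proof (induction p)
  case 0
  then show ?case by simp
next
  case (pCons a p)
  have "poly (pCons a p) (z + k * g) - poly (pCons a p) z =
    (z + k * g) * (poly p (z + k * g) - poly p z) + g * (k * poly p z)"
    by (simp add: algebra_simps)
  then show ?case using pCons.IH by (metis dvd_add dvd_mult dvd_triv_left)
qed

theorem corollary1p3:
  fixes p :: "int poly" and \<phi> :: "nat \<Rightarrow> int"
  assumes "degree p \<ge> 1" and "lead_coeff p > 0"
    and "two_colouring \<phi>"
  shows "mono_solutions p \<phi> = {} \<or> infinite (mono_solutions p \<phi>)"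
proof (rule ccontr)
  assume "\<not> ?thesis"
  then have fin: "finite (mono_solutions p \<phi>)" and "mono_solutions p \<phi> \<noteq> {}" by auto
  then obtain x y z where sol: "(x, y, z) \<in> mono_solutions p \<phi>" by auto
  have colour_iff: "\<phi> m = \<phi> n \<longleftrightarrow> (\<phi> m = 1) = (\<phi> n = 1)" if "m \<ge> 1" "n \<ge> 1" for m n
    using assms(3) that unfolding two_colouring_def by (metis empty_iff insert_iff)
  define c where "c n \<longleftrightarrow> \<phi> (nat n) = 1" for n :: int
  define thirds where "thirds = (\<lambda>(x, y, z). int z) ` mono_solutions p \<phi>"
  have "finite thirds" using fin by (simp add: thirds_def)
  then obtain B where B: "\<And>t. t \<in> thirds \<Longrightarrow> t \<le> B"
    by (metis bdd_above_finite bdd_above.E)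
  obtain M where M: "\<forall>x\<ge>M. poly (diff_poly p) x > 0"
    using poly_int_eventually_pos[of "diff_poly p"] lead_coeff_diff_poly[OF assms(1)] assms by auto
  define N where "N = max (max M (B + 1)) 1"
  interpret eventually_solution_free p c N
  proof
    show "1 \<le> N" by (simp add: N_def)
    show "poly p u < poly p v" if "N \<le> u" "u < v" for u v
      using that(2)
    proof (induction v rule: int_gr_induct)
      case base
      then show ?case using M that(1) by (auto simp: poly_diff_poly N_def)
    next
      case (step v)
      then have "poly p v < poly p (v + 1)" using M that(1) by (auto simp: poly_diff_poly N_def)
      then show ?case using step by simp
    qed
    show False if h: "N \<le> w" "1 \<le> u" "1 \<le> v" "u + v = poly p w" "c u = c v" "c v = c w" for u v w
    proof -
      have "w \<ge> 1" using h(1) by (simp add: N_def)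
      then have "(nat u, nat v, nat w) \<in> mono_solutions p \<phi>"
        using h colour_iff[of "nat u" "nat v"] colour_iff[of "nat v" "nat w"]
        by (auto simp: mono_solutions_def c_def)
      then have "w \<in> thirds" using \<open>w \<ge> 1\<close> unfolding thirds_def by force
      then show False using B[of w] h(1) by (simp add: N_def)
    qed
  qed
  define A where "A = fact (degree p) * lead_coeff p"
  have "A > 0" using assms by (simp add: A_def)
  have shift: "c (u + int k * A) = c u" if "1 \<le> u" for u k
  proof (induction k)
    case (Suc k)
    have "int k * A \<ge> 0" using \<open>A > 0\<close> by simp
    then have "1 \<le> u + int k * A" using that by simp
    then have "c (u + int k * A + A) = c (u + int k * A)"
      unfolding A_def by (intro colour_periodic assms)
    then show ?case using Suc by (simp add: algebra_simps)
  qed simp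
  have sol': "int x \<ge> 1" "int y \<ge> 1" "int z \<ge> 1" "int x + int y = poly p (int z)"
    "c (int x) = c (int y)" "c (int y) = c (int z)"
    using sol by (auto simp: mono_solutions_def c_def)
  obtain M' where M': "\<forall>w\<ge>M'. poly p w > poly p (int z)"
    using poly_dominates_diff[OF assms(1,2), of 0 "poly p (int z)"] by auto
  define k where "k = nat (max \<bar>M'\<bar> N)"
  define w where "w = int z + int k * A"
  have "int k * 1 \<le> int k * A" using \<open>A > 0\<close> by (intro mult_left_mono) auto
  then have w: "w \<ge> M'" "w \<ge> N" using sol'(3) by (auto simp: w_def k_def)
  obtain j where j: "poly p w - poly p (int z) = A * j"
    using dvd_poly_add_mult_diff[of A p "int z" "int k"] by (auto simp: w_def dvd_def)
  have "A * j > 0" using M' w(1) j by auto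
  then have "j > 0" using \<open>A > 0\<close> by (simp add: zero_less_mult_iff)
  \<comment> \<open>The new second entry differs from \<open>y\<close> by a positive multiple of the
    period and so keeps its colour.\<close>
  then have y: "poly p w - int x = int y + int (nat j) * A" using j sol'(4) by (simp add: algebra_simps)
  have cw: "c (poly p w - int x) = c (int y)" "c w = c (int z)"
    unfolding y unfolding w_def by (intro shift sol')+
  show False
  proof (rule no_solution[OF w(2), of "int x" "poly p w - int x"])
    show "1 \<le> poly p w - int x" using \<open>A * j > 0\<close> j sol' by linarith
    show "c (int x) = c (poly p w - int x)" "c (poly p w - int x) = c w"
      using cw sol' by simp_all
  qed (use sol' in auto)
qed

end
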